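(* Let $A$ be a strongly separable algebra over a field $\Bbbk$, viewed as a Frobenius algebra with respect to its trace form. The Nakayama Jacobian of every algebra automorphism of $A$ is $1$.
   Context: Algebras are associative and unital over $\Bbbk$. For a finite-dimensional algebra $A$ and $a\in A$, let $L_a:A\to A$ be $b\mapsto ab$. The trace form on $A$ is the associative symmetric bilinear form $\langle a,b\rangle_{\mathrm{tr}}=\mathrm{tr}(L_{ab})$. $A$ is strongly separable if it is finite-dimensional and this form is non-degenerate. The Nakayama Jacobian of an algebra automorphism $u:A\to A$ with respect to a non-degenerate associative bilinear form $\langle-,-\rangle$ on $A$ is the unique element $j\in A$ such that $\langle u(a),u(b)\rangle=\langle j\cdot a,b\rangle$ for all $a,b\in A$; here the form is the trace form. *)

theory Defs
  imports Complex_Main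
begin

(* The sum is taken over an arbitrary basis; the lemma trace_map_eq below shows that
   the choice is irrelevant in finite dimension. *)
definition (in vector_space) trace_map :: "('b \<Rightarrow> 'b) \<Rightarrow> 'a" where
  "trace_map f =
    (let B = (SOME B. independent B \<and> span B = UNIV) in \<Sum>b\<in>B. representation B (f b) b)"

(* The sort {ring, monoid_mult} is that of associative unital rings in which 0 = 1 is allowed,
   unlike in ring_1, so that the zero algebra is included. *)
locale unital_algebra = vector_space scale
  for scale :: "'k::field \<Rightarrow> 'a::{ring, monoid_mult} \<Rightarrow> 'a" (infixr \<open>*s\<close> 75) +
  assumes scale_mult_left: "(c *s a) * b = c *s (a * b)"
    and scale_mult_right: "a * (c *s b) = c *s (a * b)"
begin

definition finite_dimensional :: bool where
  "finite_dimensional \<longleftrightarrow> (\<exists>B. finite B \<and> span B = UNIV)"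

definition bilinear_form :: "('a \<Rightarrow> 'a \<Rightarrow> 'k) \<Rightarrow> bool" where
  "bilinear_form \<beta> \<longleftrightarrow>
    (\<forall>b. Vector_Spaces.linear scale (*) (\<lambda>a. \<beta> a b)) \<and>
    (\<forall>a. Vector_Spaces.linear scale (*) (\<lambda>b. \<beta> a b))"

definition associative_form :: "('a \<Rightarrow> 'a \<Rightarrow> 'k) \<Rightarrow> bool" where
  "associative_form \<beta> \<longleftrightarrow> (\<forall>a b c. \<beta> (a * b) c = \<beta> a (b * c))"

definition nondegenerate_form :: "('a \<Rightarrow> 'a \<Rightarrow> 'k) \<Rightarrow> bool" where
  "nondegenerate_form \<beta> \<longleftrightarrow>
    (\<forall>a. (\<forall>b. \<beta> a b = 0) \<longrightarrow> a = 0) \<and> (\<forall>b. (\<forall>a. \<beta> a b = 0) \<longrightarrow> b = 0)"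

definition trace_form :: "'a \<Rightarrow> 'a \<Rightarrow> 'k" where
  "trace_form a b = trace_map (\<lambda>c. (a * b) * c)"

definition strongly_separable :: bool where
  "strongly_separable \<longleftrightarrow> finite_dimensional \<and> nondegenerate_form trace_form"

definition algebra_automorphism :: "('a \<Rightarrow> 'a) \<Rightarrow> bool" where
  "algebra_automorphism u \<longleftrightarrow>
    Vector_Spaces.linear scale scale u \<and> bij u \<and> u 1 = 1 \<and> (\<forall>a b. u (a * b) = u a * u b)"

end

(* Existence and uniqueness for non-degenerate associative bilinear forms
   are the lemma nakayama_jacobian_ex1 below. *)
definition nakayama_jacobian :: "('a::times \<Rightarrow> 'a \<Rightarrow> 'k) \<Rightarrow> ('a \<Rightarrow> 'a) \<Rightarrow> 'a" where
  "nakayama_jacobian \<beta> u = (THE j. \<forall>a b. \<beta> (u a) (u b) = \<beta> (j * a) b)"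

lemma (in vector_space) trace_sum_basis_indep:
  assumes f: "Vector_Spaces.linear scale scale f"
    and B: "finite B" "independent B" "span B = UNIV"
    and C: "finite C" "independent C" "span C = UNIV"
  shows "(\<Sum>b\<in>B. representation B (f b) b) = (\<Sum>c\<in>C. representation C (f c) c)"
proof -
  interpret f: Vector_Spaces.linear scale scale f by fact
  have rB: "Vector_Spaces.linear scale (*) (\<lambda>v. representation B v b)" for b
    by (rule linear_representation) (use B in auto)
  have rC: "Vector_Spaces.linear scale (*) (\<lambda>v. representation C v c)" for c
    by (rule linear_representation) (use C in auto)
  have eB: "(\<Sum>b\<in>B. scale (representation B v b) b) = v" for v
    by (rule sum_representation_eq) (use B in auto)
  have eC: "(\<Sum>c\<in>C. scale (representation C v c) c) = v" for v
    by (rule sum_representation_eq) (use C in auto)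
  have 1: "representation B (f b) b = (\<Sum>c\<in>C. representation C (f b) c * representation B c b)" for b
  proof -
    interpret r: Vector_Spaces.linear scale "(*)" "\<lambda>v. representation B v b" by (rule rB)
    have "representation B (f b) b = representation B (\<Sum>c\<in>C. scale (representation C (f b) c) c) b"
      by (simp add: eC)
    also have "\<dots> = (\<Sum>c\<in>C. representation C (f b) c * representation B c b)"
      by (simp add: r.sum r.scale)
    finally show ?thesis .
  qed
  have 2: "representation C (f c) c = (\<Sum>b\<in>B. representation C (f b) c * representation B c b)" for c
  proof -
    interpret r: Vector_Spaces.linear scale "(*)" "\<lambda>v. representation C v c" by (rule rC)
    have "representation C (f c) c = representation C (f (\<Sum>b\<in>B. scale (representation B c b) b)) c"
      by (simp add: eB)
    also have "\<dots> = (\<Sum>b\<in>B. representation C (f b) c * representation B c b)"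
      by (simp add: f.sum f.scale r.sum r.scale mult.commute)
    finally show ?thesis .
  qed
  have "(\<Sum>b\<in>B. representation B (f b) b)
      = (\<Sum>b\<in>B. \<Sum>c\<in>C. representation C (f b) c * representation B c b)"
    by (rule sum.cong[OF refl 1])
  also have "\<dots> = (\<Sum>c\<in>C. \<Sum>b\<in>B. representation C (f b) c * representation B c b)"
    by (rule sum.swap)
  also have "\<dots> = (\<Sum>c\<in>C. representation C (f c) c)"
    by (rule sum.cong[OF refl 2[symmetric]])
  finally show ?thesis .
qed

lemma (in vector_space) trace_map_eq:
  assumes f: "Vector_Spaces.linear scale scale f"
    and B: "finite B" "independent B" "span B = UNIV"
  shows "trace_map f = (\<Sum>b\<in>B. representation B (f b) b)"
proof -
  define C where "C = (SOME B. independent B \<and> span B = UNIV)"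
  have C: "independent C \<and> span C = UNIV"
    unfolding C_def by (rule someI[of _ B]) (use B in auto)
  have "finite C"
    using independent_span_bound[of B C] B C by auto
  with C show ?thesis
    unfolding trace_map_def Let_def C_def[symmetric]
    by (intro trace_sum_basis_indep[OF f]) (use B in auto)
qed

context unital_algebra
begin

lemma finite_basis_exists:
  assumes "finite_dimensional"
  obtains B where "finite B" "independent B" "span B = UNIV"
proof -
  from assms obtain S where S: "finite S" "span S = UNIV"
    unfolding finite_dimensional_def by blast
  obtain B where B: "B \<subseteq> S" "independent B" "S \<subseteq> span B"
    using maximal_independent_subset[of S] by blast
  have "span S \<subseteq> span B"
    using B span_minimal by blast
  with S B show ?thesis
    by (intro that[of B]) (auto intro: finite_subset)
qed

lemma nakayama_jacobian_ex1:
  assumes fd: "finite_dimensional" and bil: "bilinear_form \<beta>"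
    and assoc: "associative_form \<beta>" and nd: "nondegenerate_form \<beta>"
    and u: "algebra_automorphism u"
  shows "\<exists>!j. \<forall>a b. \<beta> (u a) (u b) = \<beta> (j * a) b"
proof -
  obtain B where B: "finite B" "independent B" "span B = UNIV"
    using finite_basis_exists[OF fd] .
  interpret fd: finite_dimensional_vector_space scale B
    by unfold_locales (use B in auto)
  have l1: "Vector_Spaces.linear scale (*) (\<lambda>a. \<beta> a b)" for b
    using bil by (simp add: bilinear_form_def)
  have l2: "Vector_Spaces.linear scale (*) (\<lambda>b. \<beta> a b)" for a
    using bil by (simp add: bilinear_form_def)
  interpret u: Vector_Spaces.linear scale scale u
    using u by (simp add: algebra_automorphism_def)
  have um: "u 1 = 1" "u (a * b) = u a * u b" for a b
    using u by (auto simp: algebra_automorphism_def)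
  interpret K: vector_space "(*) :: 'k \<Rightarrow> 'k \<Rightarrow> 'k"
    by unfold_locales (auto simp: algebra_simps)
  interpret AK: vector_space_pair scale "(*) :: 'k \<Rightarrow> 'k \<Rightarrow> 'k" ..
  interpret AA: vector_space_pair scale scale ..
  have add: "\<beta> (a + a') b = \<beta> a b + \<beta> a' b" and sc: "\<beta> (c *s a) b = c * \<beta> a b" for a a' b c
    using AK.linear_add[OF l1] AK.linear_scale[OF l1] by auto
  define T where "T = (\<lambda>a. \<Sum>b\<in>B. \<beta> a b *s b)"
  have T: "Vector_Spaces.linear scale scale T"
    unfolding T_def
    by (intro Vector_Spaces.linear_iff[THEN iffD2] conjI allI vector_space_axioms)
      (simp_all add: add sc scale_left_distrib sum.distrib scale_sum_right)
  have coeff: "(\<Sum>b\<in>B. f b *s b) = (\<Sum>b\<in>B. g b *s b) \<Longrightarrow> b \<in> B \<Longrightarrow> f b = g b" for f g :: "'a \<Rightarrow> 'k" and b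
  proof -
    assume eq: "(\<Sum>b\<in>B. f b *s b) = (\<Sum>b\<in>B. g b *s b)" and b: "b \<in> B"
    have "(\<Sum>b\<in>B. (f b - g b) *s b) = 0"
      using eq by (simp add: scale_left_diff_distrib sum_subtractf)
    then have "f b - g b = 0"
      using independentD[OF B(2,1) subset_refl, of "\<lambda>b. f b - g b"] b by blast
    then show "f b = g b" by simp
  qed
  have ext: "Vector_Spaces.linear scale (*) f \<Longrightarrow> Vector_Spaces.linear scale (*) g \<Longrightarrow>
      (\<And>b. b \<in> B \<Longrightarrow> f b = g b) \<Longrightarrow> f v = g v" for f g :: "'a \<Rightarrow> 'k" and v
    using AK.linear_eq_on[of f g v B] B(3) by auto
  have "inj T"
  proof (subst AA.linear_inj_iff_eq_0[OF T], intro allI impI)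
    fix a assume "T a = 0"
    then have "(\<Sum>b\<in>B. \<beta> a b *s b) = (\<Sum>b\<in>B. 0 *s b)" by (simp add: T_def)
    then have "\<beta> a b = 0" if "b \<in> B" for b
      using coeff[of "\<beta> a" "\<lambda>_. 0"] that by blast
    then have "\<beta> a v = 0" for v
      using ext[OF l2 AK.linear_zero, of a v] by simp
    then show "a = 0" using nd by (auto simp: nondegenerate_form_def)
  qed
  then have "surj T" by (rule fd.linear_inj_imp_surj[OF T])
  then obtain j where "T j = (\<Sum>b\<in>B. \<beta> 1 (u b) *s b)" by (metis surjD)
  then have jB: "\<beta> j b = \<beta> 1 (u b)" if "b \<in> B" for b
    using coeff[of "\<beta> j" "\<lambda>b. \<beta> 1 (u b)"] that by (simp add: T_def)
  have lu: "Vector_Spaces.linear scale (*) (\<lambda>b. \<beta> 1 (u b))"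
    by (intro Vector_Spaces.linear_iff[THEN iffD2] conjI allI vector_space_axioms K.vector_space_axioms)
      (simp_all add: u.add u.scale AK.linear_add[OF l2] AK.linear_scale[OF l2])
  have j: "\<beta> j v = \<beta> 1 (u v)" for v
    using ext[OF l2 lu] jB by blast
  have as: "\<beta> (a * b) c = \<beta> a (b * c)" for a b c
    using assoc by (simp add: associative_form_def)
  show ?thesis
  proof (rule ex1I[of _ j])
    show "\<forall>a b. \<beta> (u a) (u b) = \<beta> (j * a) b"
      using as[of 1] by (simp add: as j um)
  next
    fix j' assume j': "\<forall>a b. \<beta> (u a) (u b) = \<beta> (j' * a) b"
    have "\<beta> j' b = \<beta> j b" for b
      using j'[rule_format, of 1 b] by (simp add: um j)
    then have "\<beta> (j' - j) b = 0" for b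
      using AK.linear_diff[OF l1, of j' j b] by simp
    then show "j' = j"
      using nd by (metis nondegenerate_form_def eq_iff_diff_eq_0)
  qed
qed

lemma trace_form_bilinear:
  assumes fd: "finite_dimensional"
  shows "bilinear_form trace_form"
proof -
  obtain B where B: "finite B" "independent B" "span B = UNIV"
    using finite_basis_exists[OF fd] .
  interpret K: vector_space "(*) :: 'k \<Rightarrow> 'k \<Rightarrow> 'k"
    by unfold_locales (auto simp: algebra_simps)
  interpret AA: vector_space_pair scale scale ..
  interpret AK: vector_space_pair scale "(*) :: 'k \<Rightarrow> 'k \<Rightarrow> 'k" ..
  have "Vector_Spaces.linear scale scale (\<lambda>c. a * c)" for a
    by (intro Vector_Spaces.linear_iff[THEN iffD2] conjI allI vector_space_axioms)
      (simp_all add: distrib_left scale_mult_right)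
  then have eq: "trace_form a b = (\<Sum>x\<in>B. representation B ((a * b) * x) x)" for a b
    unfolding trace_form_def using B by (intro trace_map_eq) auto
  have r: "representation B (v + w) x = representation B v x + representation B w x"
    "representation B (c *s v) x = c * representation B v x" for v w x c
    using B by (simp_all add: representation_add representation_scale)
  show ?thesis
    unfolding bilinear_form_def
    by (intro Vector_Spaces.linear_iff[THEN iffD2] conjI allI vector_space_axioms K.vector_space_axioms)
      (simp_all add: eq distrib_left distrib_right scale_mult_left scale_mult_right r
        sum.distrib sum_distrib_left)
qed

lemma trace_form_associative: "associative_form trace_form"
  by (simp add: associative_form_def trace_form_def mult.assoc)

lemma trace_form_nakayama_jacobian_ex1:
  assumes "strongly_separable" and "algebra_automorphism u"
  shows "\<exists>!j. \<forall>a b. trace_form (u a) (u b) = trace_form (j * a) b"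
  using assms nakayama_jacobian_ex1 trace_form_bilinear trace_form_associative
  unfolding strongly_separable_def by blast

end

end

theory Submission
  imports Defs
begin

text \<open>An algebra automorphism \<open>u\<close> satisfies \<open>L (u a) = u \<circ> L a \<circ> u\<^sup>-\<^sup>1\<close>, and the trace is invariant
  under conjugation, so \<open>u\<close> preserves the trace form; hence \<open>1\<close> satisfies the equation that
  characterises the Nakayama Jacobian.\<close>

text \<open>Applying \<open>u\<close> to the expansion of \<open>v\<close> in \<open>B\<close>
  expands \<open>u v\<close> in the image basis with the same coefficients.\<close>

lemma (in vector_space) representation_image:
  assumes u: "Vector_Spaces.linear scale scale u" "inj u"
    and B: "finite B" "independent B" "span B = UNIV"
    and C: "independent (u ` B)" "span (u ` B) = UNIV"
    and b: "b \<in> B"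
  shows "representation (u ` B) (u v) (u b) = representation B v b"
proof -
  interpret u: Vector_Spaces.linear scale scale u by fact
  interpret r: Vector_Spaces.linear scale "(*)" "\<lambda>v. representation (u ` B) v (u b)"
    by (rule linear_representation) (use C in auto)
  have "representation (u ` B) (u v) (u b)
      = representation (u ` B) (u (\<Sum>c\<in>B. scale (representation B v c) c)) (u b)"
    by (subst sum_representation_eq) (use B in auto)
  also have "\<dots> = (\<Sum>c\<in>B. representation B v c * representation (u ` B) (u c) (u b))"
    by (simp add: u.sum u.scale r.sum r.scale)
  \<comment> \<open>Injectivity gives \<open>u c = u b\<close> only for \<open>c = b\<close>, so the
    coordinates of image basis vectors are Kronecker deltas.\<close>
  also have "\<dots> = (\<Sum>c\<in>B. if b = c then representation B v c else 0)"
    using C u(2) by (intro sum.cong) (auto simp: representation_basis inj_eq)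
  also have "\<dots> = representation B v b"
    using B b by simp
  finally show ?thesis .
qed

text \<open>The trace may be computed in any finite basis: \<open>g\<close> in the image of
  \<open>B\<close> under \<open>u\<close> has the same diagonal entries as \<open>f\<close> in
  \<open>B\<close>. The assumption \<open>conj\<close> encodes conjugacy without naming the inverse
  of \<open>u\<close>.\<close>

lemma (in vector_space) trace_map_conjugate:
  assumes B: "finite B" "independent B" "span B = UNIV"
    and f: "Vector_Spaces.linear scale scale f" and g: "Vector_Spaces.linear scale scale g"
    and u: "Vector_Spaces.linear scale scale u" "bij u"
    and conj: "\<And>x. g (u x) = u (f x)"
  shows "trace_map g = trace_map f"
proof -
  interpret p: vector_space_pair scale scale ..
  have inj: "inj u" and surj: "surj u"
    using u(2) by (auto simp: bij_def)
  have C: "independent (u ` B)" "span (u ` B) = UNIV"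
    using B p.linear_independent_injective_image[OF u(1) B(2)] p.linear_span_image[OF u(1), of B]
      inj surj by (auto intro: inj_on_subset)
  have "trace_map g = (\<Sum>c\<in>u ` B. representation (u ` B) (g c) c)"
    using B C by (intro trace_map_eq g) auto
  also have "\<dots> = (\<Sum>b\<in>B. representation (u ` B) (u (f b)) (u b))"
    using inj by (subst sum.reindex) (auto intro: inj_on_subset simp: conj)
  also have "\<dots> = (\<Sum>b\<in>B. representation B (f b) b)"
    by (intro sum.cong refl representation_image u inj B C)
  also have "\<dots> = trace_map f"
    using B by (intro trace_map_eq[symmetric] f) auto
  finally show ?thesis .
qed

lemma (in unital_algebra) trace_form_automorphism:
  assumes fd: "finite_dimensional" and u: "algebra_automorphism u"
  shows "trace_form (u a) (u b) = trace_form a b"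
proof -
  obtain B where B: "finite B" "independent B" "span B = UNIV"
    using finite_basis_exists[OF fd] .
  have L: "Vector_Spaces.linear scale scale (\<lambda>c. x * c)" for x
    by (intro Vector_Spaces.linear_iff[THEN iffD2] conjI allI vector_space_axioms)
      (simp_all add: distrib_left scale_mult_right)
  \<comment> \<open>Here \<open>f\<close> and \<open>g\<close> are left multiplication by
    \<open>a * b\<close> and by \<open>u a * u b\<close>; the conjugacy condition is then
    multiplicativity of \<open>u\<close>.\<close>
  show ?thesis
    unfolding trace_form_def
    using u by (intro trace_map_conjugate[OF B L L, of u]) (auto simp: algebra_automorphism_def)
qed

theorem lemma33:
  fixes scale :: "'k::field \<Rightarrow> 'a::{ring, monoid_mult} \<Rightarrow> 'a"
    and u :: "'a \<Rightarrow> 'a"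
  assumes "unital_algebra scale"
    and "unital_algebra.strongly_separable scale"
    and "unital_algebra.algebra_automorphism scale u"
  shows "nakayama_jacobian (unital_algebra.trace_form scale) u = 1"
proof -
  interpret unital_algebra scale by fact
  have "finite_dimensional"
    using assms(2) by (simp add: strongly_separable_def)
  then have "\<forall>a b. trace_form (u a) (u b) = trace_form (1 * a) b"
    using trace_form_automorphism assms(3) by simp
  \<comment> \<open>Non-degeneracy makes the solution unique, so the definite description evaluates
    to the solution \<open>1\<close>.\<close>
  then show ?thesis
    unfolding nakayama_jacobian_def
    by (rule the1_equality[OF trace_form_nakayama_jacobian_ex1[OF assms(2,3)]])
qed

end
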